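(* Let $S^1=[-1,1]/\sim$ with $-1\sim1$, and let $f\colon S^1\to S^1$ be the continuous map induced by $$\hat f(x)=\begin{cases}2\sqrt{x}-1 & \text{if } x\ge0,\\ 1-2\sqrt{|x|} & \text{if } x<0,\end{cases}\qquad x\in[-1,1],$$ with exceptional set $\mathcal S=\{0,\pm1\}$. Then: (1) there are $0<\sigma<1$, $\delta>0$ and $\theta>0$ such that Lebesgue almost every $x\in S^1$ has frequency of $(\sigma,\delta)$-hyperbolic times bigger than $\theta$; (2) for every $0<\sigma<1$ and $\delta>0$, the map $h$ assigning to each $x\in S^1$ its first $(\sigma,\delta)$-hyperbolic time is not integrable with respect to Lebesgue measure on $S^1$.
   Context: $S^1$ carries the distance $\operatorname{dist}$ induced from the interval $[-1,1]$ with endpoints identified (a circle of length $2$), and $m$ is normalized Lebesgue measure ($\tfrac12dx$). The map $f$ is a $C^2$ local diffeomorphism outside $\mathcal S=\{0,\pm1\}$ (two points of $S^1$). Fix constants $B>1$ and $\beta>0$ for which $\mathcal S$ is a non-degenerate exceptional set for $f$, that is, for all $x\in S^1\setminus\mathcal S$, $$\frac1B\operatorname{dist}(x,\mathcal S)^\beta\le|f'(x)|\le B\operatorname{dist}(x,\mathcal S)^{-\beta},$$ and for all $x,y\in S^1\setminus\mathcal S$ with $\operatorname{dist}(x,y)<\operatorname{dist}(x,\mathcal S)/2$, $$\big|\log|f'(x)|-\log|f'(y)|\big|\le\frac{B}{\operatorname{dist}(x,\mathcal S)^\beta}\operatorname{dist}(x,y).$$ Fix $b>0$ with $b<\min\{1/2,1/(4\beta)\}$.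 The $\delta$-truncated distance is $\operatorname{dist}_\delta(x,\mathcal S)=\operatorname{dist}(x,\mathcal S)$ if $\operatorname{dist}(x,\mathcal S)\le\delta$, and $\operatorname{dist}_\delta(x,\mathcal S)=1$ otherwise. Given $0<\sigma<1$ and $\delta>0$, $n$ is a $(\sigma,\delta)$-hyperbolic time for $x$ if for all $1\le k\le n$, $$\prod_{j=n-k}^{n-1}|f'(f^j(x))|^{-1}\le\sigma^k\quad\text{and}\quad\operatorname{dist}_\delta(f^{n-k}(x),\mathcal S)\ge\sigma^{bk}.$$ The frequency of $(\sigma,\delta)$-hyperbolic times for $x$ is bigger than $\theta>0$ if for all large $n$ there are $n_1<\dots<n_\ell\le n$ which are $(\sigma,\delta)$-hyperbolic times for $x$, with $\ell\ge\theta n$. The first $(\sigma,\delta)$-hyperbolic time $h(x)$ is the smallest $n\ge1$ which is a $(\sigma,\delta)$-hyperbolic time for $x$; $h(x)=\infty$ if there is none. *)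

theory Defs
  imports "HOL-Analysis.Analysis"
begin

(* The circle [-1,1]/(-1 ~ 1) is modelled by its fundamental domain [-1,1); the class of
   the two endpoints is represented by -1. *)

definition circ :: "real set" where
  "circ = {-1..<1}"

definition circ_proj :: "real \<Rightarrow> real" where
  "circ_proj x = (if x = 1 then -1 else x)"

lemma circ_proj_image: "circ_proj ` {-1..1} = circ"
  by (force simp: circ_proj_def circ_def image_iff)

lemma circ_proj_eq_iff:
  assumes "x \<in> {-1..1}" "y \<in> {-1..1}"
  shows "circ_proj x = circ_proj y \<longleftrightarrow> x = y \<or> {x, y} = {-1, 1}"
  by (auto simp: circ_proj_def doubleton_eq_iff)

definition circ_dist :: "real \<Rightarrow> real \<Rightarrow> real" where
  "circ_dist x y = min \<bar>x - y\<bar> (2 - \<bar>x - y\<bar>)"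

definition circ_setdist :: "real \<Rightarrow> real set \<Rightarrow> real" where
  "circ_setdist x S = (INF s\<in>S. circ_dist x s)"

definition trunc_setdist :: "real \<Rightarrow> real \<Rightarrow> real set \<Rightarrow> real" where
  "trunc_setdist \<delta> x S = (if circ_setdist x S \<le> \<delta> then circ_setdist x S else 1)"

definition circ_measure :: "real measure" where
  "circ_measure = scale_measure (1/2) (restrict_space lebesgue circ)"

(* Below, deriv is only meaningful at points x \<noteq> -1 with f x \<noteq> -1, where the identity of
   (-1,1) is a chart at both x and f x. For the map studied here this covers every point
   outside the exceptional set. *)

definition nondegenerate_exceptional ::
    "(real \<Rightarrow> real) \<Rightarrow> real set \<Rightarrow> real \<Rightarrow> real \<Rightarrow> bool" where
  "nondegenerate_exceptional f S B \<beta> \<longleftrightarrow>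
     (\<forall>x \<in> circ - S.
        1 / B * circ_setdist x S powr \<beta> \<le> \<bar>deriv f x\<bar> \<and>
        \<bar>deriv f x\<bar> \<le> B * circ_setdist x S powr (- \<beta>)) \<and>
     (\<forall>x \<in> circ - S. \<forall>y \<in> circ - S.
        circ_dist x y < circ_setdist x S / 2 \<longrightarrow>
        \<bar>ln \<bar>deriv f x\<bar> - ln \<bar>deriv f y\<bar>\<bar>
          \<le> B / circ_setdist x S powr \<beta> * circ_dist x y)"

(* Hyperbolic times are positive. If the orbit of x meets S before time n, the distance
   condition fails for the corresponding k, so the value of deriv on S plays no role. *)

definition hyperbolic_time ::
    "(real \<Rightarrow> real) \<Rightarrow> real set \<Rightarrow> real \<Rightarrow> real \<Rightarrow> real \<Rightarrow> real \<Rightarrow> nat \<Rightarrow> bool" where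
  "hyperbolic_time f S b \<sigma> \<delta> x n \<longleftrightarrow>
     1 \<le> n \<and>
     (\<forall>k \<in> {1..n}.
        (\<Prod>j = n - k..<n. inverse \<bar>deriv f ((f ^^ j) x)\<bar>) \<le> \<sigma> ^ k \<and>
        trunc_setdist \<delta> ((f ^^ (n - k)) x) S \<ge> \<sigma> powr (b * real k))"

(* The finite set T is {n_1 < ... < n_l}. *)

definition hyperbolic_frequency_bigger ::
    "(real \<Rightarrow> real) \<Rightarrow> real set \<Rightarrow> real \<Rightarrow> real \<Rightarrow> real \<Rightarrow> real \<Rightarrow> real \<Rightarrow> bool" where
  "hyperbolic_frequency_bigger f S b \<sigma> \<delta> \<theta> x \<longleftrightarrow>
     (\<forall>\<^sub>F n in sequentially. \<exists>T \<subseteq> {..n}.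
        (\<forall>t \<in> T. hyperbolic_time f S b \<sigma> \<delta> x t) \<and> real (card T) \<ge> \<theta> * real n)"

definition first_hyperbolic_time ::
    "(real \<Rightarrow> real) \<Rightarrow> real set \<Rightarrow> real \<Rightarrow> real \<Rightarrow> real \<Rightarrow> real \<Rightarrow> ennreal" where
  "first_hyperbolic_time f S b \<sigma> \<delta> x =
     (if \<exists>n. hyperbolic_time f S b \<sigma> \<delta> x n
      then of_nat (LEAST n. hyperbolic_time f S b \<sigma> \<delta> x n) else \<infinity>)"

definition fhat :: "real \<Rightarrow> real" where
  "fhat x = (if x \<ge> 0 then 2 * sqrt x - 1 else 1 - 2 * sqrt \<bar>x\<bar>)"

definition fcirc :: "real \<Rightarrow> real" where
  "fcirc x = circ_proj (fhat x)"

lemma fcirc_circ_proj: "x \<in> {-1..1} \<Longrightarrow> fcirc (circ_proj x) = circ_proj (fhat x)"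
  by (auto simp: fcirc_def circ_proj_def fhat_def)

lemma fcirc_in_circ: "x \<in> circ \<Longrightarrow> fcirc x \<in> circ"
  by (auto simp: fcirc_def circ_proj_def fhat_def circ_def)

definition exceptional_set :: "real set" where
  "exceptional_set = circ_proj ` {0, 1, -1}"

end

theory Submission
  imports Defs "HOL-Real_Asymp.Real_Asymp"
begin

text \<open>
Write \<open>f\<close> for the circle map. Since \<open>\<bar>f' x\<bar> = 1 / \<surd>\<bar>x\<bar>\<close>, the map expands strongly near 0, while
\<open>\<plusminus>1\<close> is a neutral fixed point: \<open>1 - \<bar>x\<bar> = e\<close> becomes \<open>e + e\<^sup>2 / 4\<close> up to higher order, so
a point at distance \<open>e\<close> from it needs a time of order \<open>1 / e\<close> to escape (\<open>escape_bound\<close>).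

This slow escape makes the first hyperbolic time non-integrable: no hyperbolic time can occur before the
orbit has left a neighbourhood of \<open>\<plusminus>1\<close>, so the first one is at least \<open>1 / (1 - x) - K\<close> near 1
(\<open>first_hyperbolic_time_not_integrable\<close>).

For the positive frequency, fix the window \<open>[1/16, 1/4)\<close>, where \<open>\<bar>f'\<bar> \<ge> 2\<close>. If an orbit visits
it with frequency at least \<open>1/16\<close>, up to a bounded error, Pliss' lemma (\<open>pliss_record_times\<close>) gives a positive
frequency of times \<open>n\<close> such that among the last \<open>k\<close> iterates before \<open>n\<close> at least \<open>k / 32\<close> lie in the
window, for every \<open>k\<close>. Such \<open>n\<close> are hyperbolic times (\<open>record_imp_hyperbolic_time\<close>): as
\<open>\<bar>f'\<bar> \<ge> 1\<close> everywhere, expansion follows by counting visits. Slow recurrence to the exceptional set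
needs no separate average of \<open>- ln dist\<close>: an orbit that comes to distance \<open>d\<close> of that set, near 0 or near
\<open>\<plusminus>1\<close>, stays out of the window for a time of order \<open>1 / \<surd>d\<close>, which is far longer than the time
\<open>ln (1 / d)\<close> that the distance condition asks for.

It remains to see that almost every orbit visits the window with a frequency bounded below
(\<open>AE_visits_linear\<close>). The bad set \<open>Z\<close> is invariant, and by the maximal ergodic theorem
(\<open>maximal_ergodic\<close>) the window fills at most the proportion \<open>1/16\<close> of it. On the other hand, the window
fills the same proportion \<open>3/32\<close> of every invariant set, a form of ergodicity, so \<open>Z\<close> is null. This last
fact comes from the transfer operator, which preserves increasing functions; by the odd symmetry of \<open>f\<close>,
the difference between the values of the \<open>n\<close>-th iterate at \<open>y\<close> and at \<open>- y\<close> is bounded by the explicit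
function \<open>4 / (4 + n (1 - y))\<close> (\<open>transfer_oscillation\<close>). Thus the iterates of an increasing function become
constant, while their integrals over an invariant set do not change (\<open>invariant_integral_mono\<close>).
\<close>

section \<open>The circle map and its neutral fixed point\<close>

lemma abs_fcirc: "\<bar>fcirc x\<bar> = \<bar>2 * sqrt \<bar>x\<bar> - 1\<bar>"
  by (auto simp: fcirc_def circ_proj_def fhat_def)

lemma funpow_fcirc_in_circ: "x \<in> circ \<Longrightarrow> (fcirc ^^ n) x \<in> circ"
  by (induction n) (auto intro: fcirc_in_circ)

lemma exceptional_set_eq: "exceptional_set = {0, -1}"
  by (auto simp: exceptional_set_def circ_proj_def)

lemma circ_setdist_exceptional_set:
  assumes "x \<in> circ"
  shows "circ_setdist x exceptional_set = min \<bar>x\<bar> (1 - \<bar>x\<bar>)"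
proof -
  have "circ_setdist x exceptional_set = min (circ_dist x 0) (circ_dist x (-1))"
    by (simp add: circ_setdist_def exceptional_set_eq cInf_eq_Min)
  then show ?thesis
    using assms by (auto simp: circ_dist_def circ_def)
qed

lemma deriv_fcirc:
  assumes "x \<in> circ" "x \<noteq> 0"
  shows "deriv fcirc x = 1 / sqrt \<bar>x\<bar>"
proof (cases "x > 0")
  case True
  have "((\<lambda>x. 2 * sqrt x - 1) has_real_derivative 1 / sqrt \<bar>x\<bar>) (at x)"
    using True by (auto intro!: derivative_eq_intros simp: field_simps)
  moreover have "\<forall>\<^sub>F y in nhds x. y \<in> {0<..<1}"
    using True assms by (intro eventually_nhds_in_open) (auto simp: circ_def)
  then have "\<forall>\<^sub>F y in nhds x. 2 * sqrt y - 1 = fcirc y"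
    by eventually_elim (auto simp: fcirc_def circ_proj_def fhat_def)
  ultimately show ?thesis
    by (metis DERIV_cong_ev DERIV_imp_deriv)
next
  case False
  have "((\<lambda>x. 1 - 2 * sqrt (-x)) has_real_derivative 1 / sqrt \<bar>x\<bar>) (at x)"
    using False assms by (auto intro!: derivative_eq_intros simp: field_simps)
  moreover have "\<forall>\<^sub>F y in nhds x. y \<in> {..<0}"
    using False assms by (intro eventually_nhds_in_open) auto
  then have "\<forall>\<^sub>F y in nhds x. 1 - 2 * sqrt (-y) = fcirc y"
    by eventually_elim (auto simp: fcirc_def circ_proj_def fhat_def)
  ultimately show ?thesis
    by (metis DERIV_cong_ev DERIV_imp_deriv)
qed

text \<open>With \<open>e = 1 - \<bar>x\<bar>\<close>, the distance to the neutral fixed point \<open>\<plusminus>1\<close>, the claim is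
\<open>2 - 2 \<surd>(1 - e) \<le> e + e\<^sup>2\<close>: the map leaves the fixed point only at second order.\<close>

lemma escape_step:
  assumes "x \<in> circ"
  shows "1 - \<bar>fcirc x\<bar> \<le> (1 - \<bar>x\<bar>) + (1 - \<bar>x\<bar>)\<^sup>2"
proof -
  define e where "e = 1 - \<bar>x\<bar>"
  have e: "0 \<le> e" "e \<le> 1" using assms by (auto simp: e_def circ_def)
  have "1 - e / 2 - e\<^sup>2 / 2 \<le> sqrt (1 - e)"
  proof (rule real_le_rsqrt)
    have "e\<^sup>2 * (1 + e)\<^sup>2 \<le> e\<^sup>2 * 2\<^sup>2"
      using e by (intro mult_left_mono power_mono) auto
    then show "(1 - e / 2 - e\<^sup>2 / 2)\<^sup>2 \<le> 1 - e"
      by (simp add: power2_eq_square algebra_simps)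
  qed
  moreover have "sqrt (1 - e) = sqrt \<bar>x\<bar>" by (simp add: e_def)
  ultimately show ?thesis
    unfolding abs_fcirc e_def[symmetric] by simp
qed

text \<open>A step \<open>e \<mapsto> e + e\<^sup>2\<close> lowers \<open>1 / e\<close> by at most 1, so a point at distance \<open>1 / N\<close> from
\<open>\<plusminus>1\<close> is after \<open>j\<close> steps still within \<open>1 / (N - j)\<close>. The division-free form also covers
the fixed point itself, where \<open>N\<close> is arbitrary; that case is what later excludes orbits through
the exceptional set.\<close>

lemma escape_bound:
  assumes "x \<in> circ" "(1 - \<bar>x\<bar>) * N \<le> 1" "real j \<le> N"
  shows "(1 - \<bar>(fcirc ^^ j) x\<bar>) * (N - real j) \<le> 1"
  using assms(3)
proof (induction j)
  case 0
  then show ?case using assms by simp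
next
  case (Suc j)
  define y where "y = (fcirc ^^ j) x"
  define e where "e = 1 - \<bar>y\<bar>"
  have y: "y \<in> circ" using assms funpow_fcirc_in_circ by (simp add: y_def)
  then have e: "0 \<le> e" "e \<le> 1" by (auto simp: e_def circ_def)
  have IH: "e * (N - j) \<le> 1" using Suc by (simp add: e_def y_def)
  have "(1 - \<bar>fcirc y\<bar>) * (N - Suc j) \<le> (e + e\<^sup>2) * (N - Suc j)"
    using escape_step[OF y] Suc.prems by (intro mult_right_mono) (auto simp: e_def)
  also have "\<dots> = (1 + e) * (e * (N - j) - e)"
    by (simp add: power2_eq_square algebra_simps)
  also have "\<dots> \<le> (1 + e) * (1 - e)"
    using IH e by (intro mult_left_mono) auto
  also have "\<dots> \<le> 1" by (simp add: algebra_simps)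
  finally show ?case by (simp add: y_def)
qed

section \<open>Non-integrability of the first hyperbolic time\<close>

text \<open>At a hyperbolic time \<open>n\<close> the derivative of the \<open>n\<close>-th iterate is at least \<open>1 / \<sigma>^n\<close>, so some
earlier orbit point has \<open>\<bar>f'\<bar> \<ge> 1 / \<sigma>\<close>, that is \<open>\<bar>x\<bar> \<le> \<sigma>\<^sup>2\<close>. By the escape bound this
takes about \<open>1 / (1 - x)\<close> steps.\<close>

lemma hyperbolic_time_lower_bound:
  assumes "0 < \<sigma>" "\<sigma> < 1" and x: "x \<in> {0<..<1}"
    and n: "hyperbolic_time fcirc S b \<sigma> \<delta> x n"
  shows "1 / (1 - x) - 1 / (1 - \<sigma>\<^sup>2) \<le> real n"
proof -
  have xc: "x \<in> circ" using x by (auto simp: circ_def)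
  have s1: "\<sigma>\<^sup>2 < 1" using assms by (simp add: power_less_one_iff)
  have n1: "n \<ge> 1" and
    prod: "(\<Prod>j = 0..<n. inverse \<bar>deriv fcirc ((fcirc ^^ j) x)\<bar>) \<le> \<sigma> ^ n"
    using n by (auto simp: hyperbolic_time_def dest!: bspec[of _ _ n])
  have "\<exists>j<n. \<bar>(fcirc ^^ j) x\<bar> \<le> \<sigma>\<^sup>2"
  proof (rule ccontr)
    assume neg: "\<not> ?thesis"
    have "(\<Prod>j = 0..<n. \<sigma>) < (\<Prod>j = 0..<n. inverse \<bar>deriv fcirc ((fcirc ^^ j) x)\<bar>)"
    proof (rule prod_mono_strict[of 0])
      have less: "\<sigma> < inverse \<bar>deriv fcirc ((fcirc ^^ j) x)\<bar>" if "j < n" for j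
      proof -
        have *: "\<sigma>\<^sup>2 < \<bar>(fcirc ^^ j) x\<bar>" using neg that by auto
        then have "(fcirc ^^ j) x \<noteq> 0" by (auto simp: not_less[symmetric])
        then have "inverse \<bar>deriv fcirc ((fcirc ^^ j) x)\<bar> = sqrt \<bar>(fcirc ^^ j) x\<bar>"
          using deriv_fcirc[OF funpow_fcirc_in_circ[OF xc]] by simp
        with real_less_rsqrt[OF *] show ?thesis by simp
      qed
      show "\<sigma> < inverse \<bar>deriv fcirc ((fcirc ^^ 0) x)\<bar>" using less[of 0] n1 by simp
      show "0 \<le> \<sigma> \<and> \<sigma> \<le> inverse \<bar>deriv fcirc ((fcirc ^^ j) x)\<bar>"
        and "0 < inverse \<bar>deriv fcirc ((fcirc ^^ j) x)\<bar>" if "j \<in> {0..<n}" for j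
        using less[of j] that assms by auto
    qed (use n1 in auto)
    with prod show False by simp
  qed
  then obtain j where j: "j < n" "\<bar>(fcirc ^^ j) x\<bar> \<le> \<sigma>\<^sup>2" by blast
  show ?thesis
  proof (cases "real j \<le> 1 / (1 - x)")
    case True
    have "(1 - \<sigma>\<^sup>2) * (1 / (1 - x) - j) \<le> (1 - \<bar>(fcirc ^^ j) x\<bar>) * (1 / (1 - x) - j)"
      using j True by (intro mult_right_mono) auto
    also have "\<dots> \<le> 1"
      using x True by (intro escape_bound xc) auto
    finally have "1 / (1 - x) - j \<le> 1 / (1 - \<sigma>\<^sup>2)"
      using s1 by (simp add: pos_le_divide_eq mult.commute)
    then show ?thesis using j by linarith
  next
    case False
    moreover have "0 < 1 / (1 - \<sigma>\<^sup>2)" using s1 by simp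
    ultimately show ?thesis using j by linarith
  qed
qed


text \<open>Near 1 the first hyperbolic time dominates \<open>1 / (1 - x) - K\<close>, whose integral diverges
logarithmically. The comparison function \<open>g\<close> is Borel, so no measurability of the first
hyperbolic time has to be known.\<close>

lemma first_hyperbolic_time_not_integrable:
  assumes "0 < \<sigma>" "\<sigma> < 1"
  shows "(\<integral>\<^sup>+ x. first_hyperbolic_time fcirc S b \<sigma> \<delta> x \<partial>circ_measure) = \<infinity>"
proof -
  define K where "K = 1 / (1 - \<sigma>\<^sup>2)"
  define g where "g = (\<lambda>x::real. ennreal (1 / (1 - x) - K) * indicator {0<..<1} x)"
  have K: "K > 0" using assms by (simp add: K_def power_less_one_iff)
  have [measurable]: "g \<in> borel_measurable borel" unfolding g_def by measurable
  have le: "g x \<le> first_hyperbolic_time fcirc S b \<sigma> \<delta> x" for x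
  proof (cases "x \<in> {0<..<1} \<and> (\<exists>n. hyperbolic_time fcirc S b \<sigma> \<delta> x n)")
    case True
    then have "hyperbolic_time fcirc S b \<sigma> \<delta> x (LEAST n. hyperbolic_time fcirc S b \<sigma> \<delta> x n)"
      by (auto intro: LeastI)
    from hyperbolic_time_lower_bound[OF assms _ this] True show ?thesis
      by (auto simp: g_def K_def first_hyperbolic_time_def ennreal_of_nat_eq_real_of_nat
          intro!: ennreal_leI)
  next
    case False
    then show ?thesis by (auto simp: g_def first_hyperbolic_time_def indicator_def)
  qed
  have "(\<integral>\<^sup>+ x. g x \<partial>lborel) = \<infinity>"
  proof (rule ccontr)
    assume "(\<integral>\<^sup>+ x. g x \<partial>lborel) \<noteq> \<infinity>"
    then obtain C where C: "C \<ge> 0" "(\<integral>\<^sup>+ x. g x \<partial>lborel) = ennreal C"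
      by (metis ennreal_cases infinity_ennreal_def)
    have bound: "- ln (1 - t) \<le> C + K" if t: "0 \<le> t" "t < 1" for t
    proof -
      have "ennreal (- ln (1 - t) - - ln (1 - 0)) =
            (\<integral>\<^sup>+ x. ennreal (1 / (1 - x)) * indicator {0..t} x \<partial>lborel)"
        using t by (intro nn_integral_FTC_Icc[symmetric])
          (auto intro!: derivative_eq_intros simp: field_simps)
      also have "\<dots> \<le> (\<integral>\<^sup>+ x. g x + ennreal K * indicator {0..1} x \<partial>lborel)"
      proof (rule nn_integral_mono_AE)
        have "AE x in lborel. x \<noteq> (0::real)" by (rule AE_lborel_singleton)
        then show "AE x in lborel. ennreal (1 / (1 - x)) * indicator {0..t} x
                     \<le> g x + ennreal K * indicator {0..1} x"
        proof eventually_elim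
          case (elim x)
          have "ennreal (1 / (1 - x)) \<le> ennreal (max 0 (1 / (1 - x) - K) + K)"
            by (rule ennreal_leI) simp
          also have "\<dots> = ennreal (max 0 (1 / (1 - x) - K)) + ennreal K"
            using K by (intro ennreal_plus) auto
          finally show ?case using elim t
            by (auto simp: g_def indicator_def max_def ennreal_neg split: if_splits)
        qed
      qed
      also have "\<dots> = ennreal C + ennreal K"
        using C K by (subst nn_integral_add) (auto simp: nn_integral_cmult_indicator)
      also have "\<dots> = ennreal (C + K)" using C K by (simp add: ennreal_plus)
      finally show ?thesis using C K by (simp add: ennreal_le_iff del: ennreal_plus)
    qed
    \<comment> \<open>the point where \<open>- ln (1 - t)\<close> equals \<open>C + K + 1\<close>\<close>
    have "- ln (1 - (1 - exp (- (C + K + 1)))) \<le> C + K"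
      using C K by (intro bound) auto
    then show False by simp
  qed
  moreover have "(\<integral>\<^sup>+ x. g x \<partial>circ_measure) = 1 / 2 * (\<integral>\<^sup>+ x. g x \<partial>lborel)"
  proof -
    have [measurable]: "g \<in> borel_measurable lebesgue"
      by (rule measurable_completion) simp
    have c: "circ \<in> sets borel" unfolding circ_def by simp
    have "(\<integral>\<^sup>+ x. g x \<partial>circ_measure) = 1 / 2 * (\<integral>\<^sup>+ x. g x \<partial>restrict_space lebesgue circ)"
      unfolding circ_measure_def
      by (subst nn_integral_scale_measure) (auto intro!: measurable_restrict_space1)
    also have "(\<integral>\<^sup>+ x. g x \<partial>restrict_space lebesgue circ) = (\<integral>\<^sup>+ x. g x * indicator circ x \<partial>lebesgue)"
      using c by (intro nn_integral_restrict_space) auto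
    also have "(\<lambda>x. g x * indicator circ x) = g"
      by (auto simp: g_def circ_def indicator_def fun_eq_iff)
    also have "(\<integral>\<^sup>+ x. g x \<partial>lebesgue) = (\<integral>\<^sup>+ x. g x \<partial>lborel)"
      by (rule nn_integral_completion)
    finally show ?thesis .
  qed
  moreover have "(\<integral>\<^sup>+ x. g x \<partial>circ_measure) \<le>
      (\<integral>\<^sup>+ x. first_hyperbolic_time fcirc S b \<sigma> \<delta> x \<partial>circ_measure)"
    by (intro nn_integral_mono le)
  ultimately show ?thesis
    by (simp add: ennreal_mult_top top_unique ennreal_divide_eq_0_iff)
qed

section \<open>The maximal ergodic theorem\<close>

text \<open>The maximum of the Birkhoff sums of length at most \<open>n\<close> (the empty sum included), defined by the
recursion on which Garsia's argument rests.\<close>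

primrec max_birkhoff :: "('a \<Rightarrow> 'a) \<Rightarrow> ('a \<Rightarrow> real) \<Rightarrow> nat \<Rightarrow> 'a \<Rightarrow> real" where
  "max_birkhoff T g 0 x = 0"
| "max_birkhoff T g (Suc n) x = max 0 (g x + max_birkhoff T g n (T x))"

lemma max_birkhoff_nonneg: "0 \<le> max_birkhoff T g n x"
  by (cases n) auto

lemma max_birkhoff_mono: "max_birkhoff T g n x \<le> max_birkhoff T g (Suc n) x"
proof (induction n arbitrary: x)
  case (Suc n)
  have "max_birkhoff T g n (T x) \<le> max_birkhoff T g (Suc n) (T x)" by (rule Suc)
  then show ?case unfolding max_birkhoff.simps(2)[of T g n x] max_birkhoff.simps(2)[of T g "Suc n" x]
    by (intro max.mono) auto
qed simp

lemma birkhoff_sum_le_max: "(\<Sum>i<n. g ((T ^^ i) x)) \<le> max_birkhoff T g n x"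
proof (induction n arbitrary: x)
  case (Suc n)
  have "(\<Sum>i<Suc n. g ((T ^^ i) x)) = g x + (\<Sum>i<n. g ((T ^^ i) (T x)))"
    unfolding sum.lessThan_Suc_shift by (simp add: funpow_swap1)
  with Suc[of "T x"] show ?case by simp
qed simp

lemma max_birkhoff_le:
  assumes "\<And>x. \<bar>g x\<bar> \<le> C"
  shows "max_birkhoff T g n x \<le> real n * C"
proof (induction n arbitrary: x)
  case (Suc n)
  have "\<bar>g x\<bar> \<le> C" "max_birkhoff T g n (T x) \<le> real n * C" using assms Suc by auto
  moreover from this have "0 \<le> C" by linarith
  ultimately show ?case by (auto simp: algebra_simps)
qed simp

lemma max_birkhoff_measurable [measurable]:
  assumes [measurable]: "T \<in> measurable M M" "g \<in> borel_measurable M"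
  shows "max_birkhoff T g n \<in> borel_measurable M"
proof (induction n)
  case 0
  then show ?case by (simp add: fun_eq_iff[of "max_birkhoff T g 0", simplified])
next
  case (Suc n)
  note [measurable] = Suc
  have "(\<lambda>x. max 0 (g x + max_birkhoff T g n (T x))) \<in> borel_measurable M"
    by measurable
  then show ?case by (simp add: max_birkhoff.simps(2)[abs_def] cong: measurable_cong)
qed

text \<open>The maximal ergodic theorem on an invariant set, by Garsia's argument. Let \<open>m n\<close> be the maximal
Birkhoff sum. Where \<open>m (n + 1) > 0\<close> it equals \<open>g + m n \<circ> T\<close>, and \<open>m n \<circ> T\<close> has the same
integral over \<open>Z\<close> as \<open>m n \<le> m (n + 1)\<close>; hence \<open>g\<close> has nonnegative integral over
\<open>Z \<inter> {m (n + 1) > 0}\<close>. These sets exhaust \<open>Z\<close>.\<close>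

lemma (in finite_measure) maximal_ergodic:
  fixes g :: "'a \<Rightarrow> real"
  assumes T [measurable]: "T \<in> measurable M M"
    and inv: "distr M M T = M"
    and g [measurable]: "g \<in> borel_measurable M" and bnd: "\<And>x. \<bar>g x\<bar> \<le> C"
    and Z [measurable]: "Z \<in> sets M"
    and Zinv: "\<And>x. x \<in> space M \<Longrightarrow> T x \<in> Z \<longleftrightarrow> x \<in> Z"
    and pos: "\<And>x. x \<in> Z \<Longrightarrow> \<exists>n. 0 < (\<Sum>i<n. g ((T ^^ i) x))"
  shows "0 \<le> (\<integral>x. indicator Z x * g x \<partial>M)"
proof -
  define m where "m = max_birkhoff T g"
  define P where "P = (\<lambda>n. {x \<in> space M. x \<in> Z \<and> 0 < m (Suc n) x})"
  have [measurable]: "m n \<in> borel_measurable M" for n unfolding m_def by measurable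
  have [measurable]: "P n \<in> sets M" for n unfolding P_def by measurable
  have C: "0 \<le> C" using bnd[of undefined] by linarith
  have mb: "\<bar>m n x\<bar> \<le> real n * C" for n x
    using max_birkhoff_le[OF bnd] max_birkhoff_nonneg[of T g n x] by (simp add: m_def)
  have im: "integrable M (\<lambda>x. indicator A x * m n (h x))"
    if [measurable]: "A \<in> sets M" "h \<in> measurable M M" for A n h
    by (rule integrable_const_bound[where B="real n * C"])
       (use mb C in \<open>auto simp: indicator_def\<close>)
  have ig: "integrable M (\<lambda>x. indicator A x * g x)" if [measurable]: "A \<in> sets M" for A
    by (rule integrable_const_bound[where B=C]) (use bnd C in \<open>auto simp: indicator_def\<close>)
  have nonneg: "0 \<le> (\<integral>x. indicator (P n) x * g x \<partial>M)" for n
  proof -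
    have "(\<integral>x. indicator Z x * m n x \<partial>M) \<le> (\<integral>x. indicator Z x * m (Suc n) x \<partial>M)"
    proof (rule integral_mono)
      show "integrable M (\<lambda>x. indicator Z x * m n x)" "integrable M (\<lambda>x. indicator Z x * m (Suc n) x)"
        using im[of Z "\<lambda>x. x"] by simp_all
      show "indicator Z x * m n x \<le> indicator Z x * m (Suc n) x" for x
        unfolding m_def by (intro mult_left_mono max_birkhoff_mono) simp
    qed
    also have "\<dots> = (\<integral>x. indicator (P n) x * g x + indicator (P n) x * m n (T x) \<partial>M)"
      by (intro Bochner_Integration.integral_cong)
         (auto simp: P_def m_def indicator_def max_def split: if_splits)
    also have "\<dots> = (\<integral>x. indicator (P n) x * g x \<partial>M) + (\<integral>x. indicator (P n) x * m n (T x) \<partial>M)"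
      by (intro Bochner_Integration.integral_add ig im) auto
    also have "(\<integral>x. indicator (P n) x * m n (T x) \<partial>M) \<le> (\<integral>x. indicator Z x * m n (T x) \<partial>M)"
    proof (rule integral_mono)
      show "indicator (P n) x * m n (T x) \<le> indicator Z x * m n (T x)" for x
        using max_birkhoff_nonneg[of T g n "T x"]
        by (intro mult_right_mono) (auto simp: P_def m_def indicator_def)
    qed (intro im; measurable)+
    also have "\<dots> = (\<integral>x. indicator Z (T x) * m n (T x) \<partial>M)"
      using Zinv by (intro Bochner_Integration.integral_cong) (auto simp: indicator_def)
    also have "\<dots> = (\<integral>x. indicator Z x * m n x \<partial>distr M M T)"
      by (subst integral_distr) auto
    finally show ?thesis by (simp add: inv)
  qed
  have "(\<lambda>n. \<integral>x. indicator (P n) x * g x \<partial>M) \<longlonglongrightarrow> (\<integral>x. indicator Z x * g x \<partial>M)"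
  proof (rule integral_dominated_convergence[where w="\<lambda>_. C"])
    have "(\<lambda>n. indicator (P n) x * g x) \<longlonglongrightarrow> indicator Z x * g x" if x: "x \<in> space M" for x
    proof (cases "x \<in> Z")
      case True
      then obtain n where "0 < (\<Sum>i<n. g ((T ^^ i) x))" using pos by blast
      then have "0 < m n x"
        unfolding m_def using birkhoff_sum_le_max[where T=T and g=g and n=n and x=x] by linarith
      moreover have "m n x \<le> m (Suc k) x" if "n \<le> k" for k
        unfolding m_def
        using lift_Suc_mono_le[of "\<lambda>n. max_birkhoff T g n x" n "Suc k", OF max_birkhoff_mono] that
        by simp
      ultimately have "\<forall>k\<ge>n. x \<in> P k" using True x by (force simp: P_def)
      then show ?thesis using True
        by (intro tendsto_eventually) (auto simp: eventually_sequentially indicator_def)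
    next
      case False
      then show ?thesis by (simp add: P_def)
    qed
    then show "AE x in M. (\<lambda>n. indicator (P n) x * g x) \<longlonglongrightarrow> indicator Z x * g x" by simp
  qed (use bnd C in \<open>auto simp: indicator_def\<close>)
  then show ?thesis
    by (rule LIMSEQ_le_const) (use nonneg in auto)
qed

section \<open>The transfer operator\<close>

abbreviation lborel_circ :: "real measure" where
  "lborel_circ \<equiv> restrict_space lborel circ"

lemma circ_borel [measurable]: "circ \<in> sets borel"
  by (simp add: circ_def)

lemma fcirc_borel [measurable]: "fcirc \<in> borel_measurable borel"
  unfolding fcirc_def[abs_def] circ_proj_def fhat_def by measurable

lemma space_lborel_circ: "space lborel_circ = circ"
  by (simp add: space_restrict_space)

lemma borel_imp_lborel_circ: "g \<in> borel_measurable borel \<Longrightarrow> g \<in> borel_measurable lborel_circ"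
  by (intro measurable_restrict_space1) simp

lemma fcirc_measurable_circ: "fcirc \<in> measurable lborel_circ lborel_circ"
  by (intro measurable_restrict_space3) (auto intro: fcirc_in_circ)

interpretation lborel_circ: finite_measure lborel_circ
  by standard (simp add: space_restrict_space emeasure_restrict_space circ_def)

lemma integral_lborel_circ:
  "integral\<^sup>L lborel_circ g = (LBINT x. indicator circ x * (g x :: real))"
  by (subst integral_restrict_space) auto

text \<open>The Perron-Frobenius operator: the two inverse branches are \<open>((1 + y) / 2)\<^sup>2\<close> and
\<open>- ((1 - y) / 2)\<^sup>2\<close>, with derivatives \<open>(1 + y) / 2\<close> and \<open>(1 - y) / 2\<close>. These weights
add up to 1, which is why Lebesgue measure is invariant.\<close>

definition transfer :: "(real \<Rightarrow> real) \<Rightarrow> real \<Rightarrow> real" where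
  "transfer g y = (1 + y) / 2 * g (((1 + y) / 2)\<^sup>2) + (1 - y) / 2 * g (- ((1 - y) / 2)\<^sup>2)"

lemma transfer_measurable [measurable]:
  assumes [measurable]: "g \<in> borel_measurable borel"
  shows "transfer g \<in> borel_measurable borel"
  unfolding transfer_def[abs_def] by measurable

lemma fcirc_right_inverse:
  assumes "y \<in> circ" shows "fcirc (((1 + y) / 2)\<^sup>2) = y"
proof -
  have "sqrt (((1 + y) / 2)\<^sup>2) = (1 + y) / 2"
    unfolding real_sqrt_abs using assms by (simp add: circ_def)
  then have "fhat (((1 + y) / 2)\<^sup>2) = y" by (simp add: fhat_def) (simp add: field_simps)
  then show ?thesis using assms by (simp add: fcirc_def circ_proj_def circ_def)
qed

lemma fcirc_left_inverse:
  assumes "y \<in> circ" shows "fcirc (- ((1 - y) / 2)\<^sup>2) = y"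
proof -
  have "((1 - y) / 2)\<^sup>2 > 0" using assms by (auto simp: circ_def)
  moreover have "sqrt (((1 - y) / 2)\<^sup>2) = (1 - y) / 2"
    unfolding real_sqrt_abs using assms by (simp add: circ_def)
  ultimately have "fhat (- ((1 - y) / 2)\<^sup>2) = y" by (simp add: fhat_def) (simp add: field_simps)
  then show ?thesis using assms by (simp add: fcirc_def circ_proj_def circ_def)
qed

text \<open>Duality, by substituting along the two inverse branches.\<close>

lemma integral_transfer:
  assumes g [measurable]: "g \<in> borel_measurable borel" and gb: "\<And>x. x \<in> {-1..1} \<Longrightarrow> \<bar>g x\<bar> \<le> C"
    and h [measurable]: "h \<in> borel_measurable borel" and hb: "\<And>x. \<bar>h x\<bar> \<le> D"
  shows "(\<integral>x. g x * h (fcirc x) \<partial>lborel_circ) = (\<integral>y. transfer g y * h y \<partial>lborel_circ)"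
proof -
  define F where "F = (\<lambda>x. g x * h (fcirc x))"
  have [measurable]: "F \<in> borel_measurable borel" unfolding F_def by measurable
  have C: "0 \<le> C" using gb[of 0] by simp
  have Fb: "\<bar>F x\<bar> \<le> C * D" if "x \<in> {-1..1}" for x
    unfolding F_def abs_mult using that by (intro mult_mono gb hb C) auto
  have int: "integrable lborel (\<lambda>x. indicator A x * (k x * F (p x)))"
    if [measurable]: "A \<in> sets borel" "p \<in> borel_measurable borel" "k \<in> borel_measurable borel"
      and "A \<subseteq> {-1..1}" and pA: "\<And>x. x \<in> A \<Longrightarrow> p x \<in> {-1..1}" and kb: "\<And>x. x \<in> {-1..1} \<Longrightarrow> \<bar>k x\<bar> \<le> 1" for A and p k :: "real \<Rightarrow> real"
  proof (rule Bochner_Integration.integrable_bound[of lborel "\<lambda>x. indicator {-1..1} x * (C * D)"])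
    show "AE x in lborel. norm (indicator A x * (k x * F (p x))) \<le> norm (indicator {-1..1::real} x * (C * D))"
    proof (rule AE_I2)
      fix x :: real
      have "\<bar>F (p x)\<bar> \<le> \<bar>C * D\<bar>" if "x \<in> A" using Fb[OF pA[OF that]] by linarith
      then show "norm (indicator A x * (k x * F (p x))) \<le> norm (indicator {-1..1::real} x * (C * D))"
        using kb[of x] \<open>A \<subseteq> {-1..1}\<close> mult_mono[of "\<bar>k x\<bar>" 1 "\<bar>F (p x)\<bar>" "\<bar>C * D\<bar>"]
        by (auto simp: indicator_def abs_mult)
    qed
  qed auto
  have si: "set_integrable lborel A F" if "A \<in> sets borel" "A \<subseteq> {-1..1}" for A
    using int[of A "\<lambda>x. x" "\<lambda>_. 1"] that(1) subsetD[OF that(2)] that(2) by (simp add: set_integrable_def)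
  have right: "(LBINT x. F x * indicator {0..1} x) =
      (LBINT y. F (((1 + y) / 2)\<^sup>2) * ((1 + y) / 2) * indicator {-1..1} y)"
  proof -
    define p q :: "real \<Rightarrow> real" where "p = (\<lambda>y. ((1 + y) / 2)\<^sup>2)" and "q = (\<lambda>y. (1 + y) / 2)"
    have p: "p (-1) = 0" "p 1 = 1" by (simp_all add: p_def)
    have "(LBINT x. F x * indicator {p (-1)..p 1} x) = (LBINT y. F (p y) * q y * indicator {-1..1} y)"
    proof (rule integral_substitution(2))
      show "set_integrable lborel {p (-1)..p 1} F" unfolding p by (rule si) auto
      show "(p has_real_derivative q y) (at y)" for y
        unfolding p_def q_def by (auto intro!: derivative_eq_intros simp: field_simps)
      show "continuous_on {-1..1} q" unfolding q_def by (intro continuous_intros) simp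
    qed (auto simp: q_def)
    then show ?thesis unfolding p by (simp only: p_def q_def)
  qed
  have left: "(LBINT x. F x * indicator {-1..0} x) =
      (LBINT y. F (- ((1 - y) / 2)\<^sup>2) * ((1 - y) / 2) * indicator {-1..1} y)"
  proof -
    define p q :: "real \<Rightarrow> real" where "p = (\<lambda>y. - ((1 - y) / 2)\<^sup>2)" and "q = (\<lambda>y. (1 - y) / 2)"
    have p: "p (-1) = -1" "p 1 = 0" by (simp_all add: p_def)
    have "(LBINT x. F x * indicator {p (-1)..p 1} x) = (LBINT y. F (p y) * q y * indicator {-1..1} y)"
    proof (rule integral_substitution(2))
      show "set_integrable lborel {p (-1)..p 1} F" unfolding p by (rule si) auto
      show "(p has_real_derivative q y) (at y)" for y
        unfolding p_def q_def by (auto intro!: derivative_eq_intros simp: field_simps)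
      show "continuous_on {-1..1} q" unfolding q_def by (intro continuous_intros) simp
    qed (auto simp: q_def)
    then show ?thesis unfolding p by (simp only: p_def q_def)
  qed
  have ne: "AE x in lborel. x \<noteq> a" for a :: real by (rule AE_lborel_singleton)
  have "(\<integral>x. F x \<partial>lborel_circ) = (LBINT x. F x * indicator {-1..0} x + F x * indicator {0..1} x)"
    unfolding integral_lborel_circ
    by (rule integral_cong_AE) (use ne[of 0] ne[of 1] in \<open>auto simp: circ_def indicator_def\<close>)
  also have "\<dots> = (LBINT x. F x * indicator {-1..0} x) + (LBINT x. F x * indicator {0..1} x)"
    using si[of "{-1..0}"] si[of "{0..1}"]
    by (intro Bochner_Integration.integral_add) (auto simp: set_integrable_def mult.commute)
  also have "\<dots> = (LBINT y. F (- ((1 - y) / 2)\<^sup>2) * ((1 - y) / 2) * indicator {-1..1} y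
                        + F (((1 + y) / 2)\<^sup>2) * ((1 + y) / 2) * indicator {-1..1} y)"
    unfolding left right
  proof (rule Bochner_Integration.integral_add[symmetric])
    have sq: "((1 + y) / 2)\<^sup>2 \<in> {0..1}" "((1 - y) / 2)\<^sup>2 \<in> {0..1}" if "y \<in> {-1..1}" for y :: real
      using that by (auto intro!: power_le_one)
    have "- ((1 - y) / 2)\<^sup>2 \<in> {-1..1}" "((1 + y) / 2)\<^sup>2 \<in> {-1..1}" if "y \<in> {-1..1}" for y :: real
      using sq[OF that] unfolding atLeastAtMost_iff by linarith+
    then show "integrable lborel (\<lambda>y. F (- ((1 - y) / 2)\<^sup>2) * ((1 - y) / 2) * indicator {-1..1} y)"
      and "integrable lborel (\<lambda>y. F (((1 + y) / 2)\<^sup>2) * ((1 + y) / 2) * indicator {-1..1} y)"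
      using int[of "{-1..1}" "\<lambda>y. - ((1 - y) / 2)\<^sup>2" "\<lambda>y. (1 - y) / 2"]
        int[of "{-1..1}" "\<lambda>y. ((1 + y) / 2)\<^sup>2" "\<lambda>y. (1 + y) / 2"]
      by (simp_all add: ac_simps)
  qed
  also have "\<dots> = (\<integral>y. transfer g y * h y \<partial>lborel_circ)"
    unfolding integral_lborel_circ
  proof (rule integral_cong_AE)
    show "AE y in lborel. F (- ((1 - y) / 2)\<^sup>2) * ((1 - y) / 2) * indicator {-1..1} y
             + F (((1 + y) / 2)\<^sup>2) * ((1 + y) / 2) * indicator {-1..1} y
             = indicator circ y * (transfer g y * h y)"
      using ne[of 1]
    proof eventually_elim
      case (elim y)
      show ?case
      proof (cases "y \<in> circ")
        case True
        then have "y \<in> {-1..1}" by (auto simp: circ_def)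
        then show ?thesis using True
          by (simp add: F_def transfer_def fcirc_left_inverse fcirc_right_inverse algebra_simps)
      next
        case False
        then have "y \<notin> {-1..1}" using elim by (auto simp: circ_def)
        then show ?thesis using False by simp
      qed
    qed
  qed auto
  finally show ?thesis by (simp add: F_def)
qed

lemma distr_fcirc: "distr lborel_circ lborel_circ fcirc = lborel_circ"
proof (rule measure_eqI)
  fix A assume "A \<in> sets (distr lborel_circ lborel_circ fcirc)"
  then have A: "A \<in> sets borel" "A \<subseteq> circ"
    by (auto simp: sets_restrict_space_iff)
  then have A' [measurable]: "A \<in> sets lborel_circ" "A \<in> sets borel"
    by (auto simp: sets_restrict_space_iff)
  note [measurable] = fcirc_measurable_circ
  have [simp]: "transfer (\<lambda>_. 1) = (\<lambda>_. 1)"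
    by (simp add: transfer_def fun_eq_iff field_simps)
  have [simp]: "A \<inter> circ = A" using A by blast
  have "measure (distr lborel_circ lborel_circ fcirc) A = (\<integral>x. indicator A x \<partial>distr lborel_circ lborel_circ fcirc)"
    by (simp add: space_lborel_circ)
  also have "\<dots> = (\<integral>x. 1 * indicator A (fcirc x) \<partial>lborel_circ)"
    by (subst integral_distr) auto
  also have "\<dots> = (\<integral>x. indicator A x \<partial>lborel_circ)"
    by (subst integral_transfer[where C=1 and D=1]) (auto split: split_indicator)
  also have "\<dots> = measure lborel_circ A"
    by (simp add: space_lborel_circ)
  finally show "emeasure (distr lborel_circ lborel_circ fcirc) A = emeasure lborel_circ A"
    by (simp add: lborel_circ.emeasure_eq_measure
      finite_measure.emeasure_eq_measure[OF lborel_circ.finite_measure_distr[OF fcirc_measurable_circ]])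
qed simp

lemma transfer_bounds:
  assumes "\<And>x. x \<in> {-1..1} \<Longrightarrow> g x \<in> {0..1}" "y \<in> {-1..1}"
  shows "transfer g y \<in> {0..1}"
proof -
  define a where "a = (1 + y) / 2"
  have a: "0 \<le> a" "a \<le> 1" "(1 - y) / 2 = 1 - a" using assms by (auto simp: a_def field_simps)
  have "g (a\<^sup>2) \<in> {0..1}" "g (- (1 - a)\<^sup>2) \<in> {0..1}"
    using a by (intro assms; auto simp: power_le_one intro: order_trans[of _ 0])+
  then have "a * g (a\<^sup>2) \<le> a * 1" "(1 - a) * g (- (1 - a)\<^sup>2) \<le> (1 - a) * 1"
    "0 \<le> a * g (a\<^sup>2)" "0 \<le> (1 - a) * g (- (1 - a)\<^sup>2)"
    using a by (intro mult_left_mono mult_nonneg_nonneg; simp)+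
  then show ?thesis by (simp add: transfer_def a(3) flip: a_def)
qed

text \<open>The operator averages \<open>g\<close> over one point of each branch. As \<open>y\<close> grows, both points move to the
right and weight is shifted to the right branch, where an increasing \<open>g\<close> is larger.\<close>

lemma transfer_mono:
  assumes "mono_on {-1..1} g"
  shows "mono_on {-1..1} (transfer g)"
proof (rule mono_onI)
  fix y y' :: real assume y: "y \<in> {-1..1}" "y' \<in> {-1..1}" "y \<le> y'"
  define a a' where "a = (1 + y) / 2" and "a' = (1 + y') / 2"
  have a: "0 \<le> a" "a \<le> a'" "a' \<le> 1" "(1 - y) / 2 = 1 - a" "(1 - y') / 2 = 1 - a'"
    using y by (auto simp: a_def a'_def field_simps)
  have sq: "a\<^sup>2 \<le> a'\<^sup>2" "(1 - a')\<^sup>2 \<le> (1 - a)\<^sup>2" "a\<^sup>2 \<le> 1" "a'\<^sup>2 \<le> 1" "(1 - a)\<^sup>2 \<le> 1" "(1 - a')\<^sup>2 \<le> 1"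
    "0 \<le> a\<^sup>2" "0 \<le> a'\<^sup>2" "0 \<le> (1 - a)\<^sup>2" "0 \<le> (1 - a')\<^sup>2"
    using a by (auto intro!: power_mono power_le_one)
  have mem: "a\<^sup>2 \<in> {-1..1}" "a'\<^sup>2 \<in> {-1..1}" "- (1 - a)\<^sup>2 \<in> {-1..1}" "- (1 - a')\<^sup>2 \<in> {-1..1}"
      and "- (1 - a)\<^sup>2 \<le> a\<^sup>2" "- (1 - a)\<^sup>2 \<le> - (1 - a')\<^sup>2"
    unfolding atLeastAtMost_iff using sq by linarith+
  then have "g (a\<^sup>2) \<le> g (a'\<^sup>2)" "g (- (1 - a)\<^sup>2) \<le> g (- (1 - a')\<^sup>2)" "g (- (1 - a)\<^sup>2) \<le> g (a\<^sup>2)"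
    using mono_onD[OF assms mem(1,2) sq(1)] mono_onD[OF assms mem(3,4)] mono_onD[OF assms mem(3,1)]
    by blast+
  then have "0 \<le> a' * (g (a'\<^sup>2) - g (a\<^sup>2))" "0 \<le> (1 - a') * (g (- (1 - a')\<^sup>2) - g (- (1 - a)\<^sup>2))"
      "0 \<le> (a' - a) * (g (a\<^sup>2) - g (- (1 - a)\<^sup>2))"
    using a by (intro mult_nonneg_nonneg; simp)+
  then show "transfer g y \<le> transfer g y'"
    by (simp add: transfer_def a(4,5) algebra_simps flip: a_def a'_def)
qed

lemma transfer_iter:
  assumes "mono_on {-1..1} g" "\<And>x. x \<in> {-1..1} \<Longrightarrow> g x \<in> {0..1}"
  shows "mono_on {-1..1} ((transfer ^^ n) g)"
    and "x \<in> {-1..1} \<Longrightarrow> (transfer ^^ n) g x \<in> {0..1}"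
proof -
  show "mono_on {-1..1} ((transfer ^^ n) g)"
    by (induction n) (use assms transfer_mono in auto)
  show "x \<in> {-1..1} \<Longrightarrow> (transfer ^^ n) g x \<in> {0..1}"
  proof (induction n arbitrary: x)
    case (Suc n)
    then show ?case using transfer_bounds[of "(transfer ^^ n) g" x] by simp
  qed (use assms in simp)
qed

text \<open>The quantitative heart. Write \<open>D n y\<close> for the left-hand side and \<open>a = (1 + y) / 2\<close>. The symmetry
\<open>f (- x) = - f x\<close> gives \<open>D (n + 1) y = a D n (a\<^sup>2) - (1 - a) D n ((1 - a)\<^sup>2)\<close>; the subtracted term is
nonnegative by monotonicity, so \<open>D (n + 1) y \<le> a D n (a\<^sup>2)\<close>. The factors along the orbit of \<open>y\<close> under
\<open>y \<mapsto> a\<^sup>2\<close>, which tends to the fixed point 1 like \<open>1 - 4 / n\<close>, have a product of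
order \<open>1 / n\<^sup>2\<close>. The bound, of order \<open>1 / n\<close>, is chosen so that it reproduces itself under this recursion.\<close>

lemma transfer_oscillation:
  assumes "mono_on {-1..1} g" "\<And>x. x \<in> {-1..1} \<Longrightarrow> g x \<in> {0..1}" and y: "y \<in> {0..1}"
  shows "(transfer ^^ n) g y - (transfer ^^ n) g (- y) \<le> 4 / (4 + real n * (1 - y))"
  using y
proof (induction n arbitrary: y)
  case 0
  then show ?case using assms(2)[of y] assms(2)[of "-y"] by auto
next
  case (Suc n)
  define G where "G = (transfer ^^ n) g"
  define s where "s = 1 - y"
  define a where "a = (1 + y) / 2"
  have s: "0 \<le> s" "s \<le> 1" "a = 1 - s / 2" "(1 - y) / 2 = s / 2" "y = 1 - s"
    using Suc.prems by (auto simp: s_def a_def add_divide_distrib diff_divide_distrib)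
  have a: "0 \<le> a" "a \<le> 1" "a\<^sup>2 \<in> {0..1}" "(1 - a)\<^sup>2 \<in> {0..1}" "(1 - a)\<^sup>2 \<le> 1"
    using s by (auto intro: power_le_one)
  have "transfer G y - transfer G (- y) =
      a * (G (a\<^sup>2) - G (- a\<^sup>2)) - (1 - a) * (G ((1 - a)\<^sup>2) - G (- (1 - a)\<^sup>2))"
    by (simp add: transfer_def a_def algebra_simps diff_divide_distrib add_divide_distrib)
  also have "\<dots> \<le> a * (G (a\<^sup>2) - G (- a\<^sup>2))"
  proof -
    have "G (- (1 - a)\<^sup>2) \<le> G ((1 - a)\<^sup>2)"
      unfolding G_def
    proof (rule mono_onD[OF transfer_iter(1)[OF assms(1,2)]])
      show "(1 - a)\<^sup>2 \<in> {-1..1}" "- (1 - a)\<^sup>2 \<in> {-1..1}" "- (1 - a)\<^sup>2 \<le> (1 - a)\<^sup>2"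
        using a(4) unfolding atLeastAtMost_iff by linarith+
    qed
    then show ?thesis using a by simp
  qed
  also have "\<dots> \<le> a * (4 / (4 + real n * (1 - a\<^sup>2)))"
    unfolding G_def using a by (intro mult_left_mono Suc.IH) auto
  also have "\<dots> \<le> 4 / (4 + real (Suc n) * (1 - y))"
  proof -
    have pos: "0 < 4 + real n * (1 - a\<^sup>2)" "0 < 4 + real (Suc n) * s"
      using a s by (auto intro!: add_pos_nonneg)
    have "(1 - s / 2) * (4 + (real n + 1) * s) \<le> 4 + real n * (s - s\<^sup>2 / 4)"
    proof -
      have "0 \<le> s + (real n / 4 + 1/2) * s\<^sup>2" using s by auto
      then show ?thesis by (simp add: power2_eq_square algebra_simps)
    qed
    moreover have "1 - a\<^sup>2 = s - s\<^sup>2 / 4"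
      by (simp add: s(3) power2_eq_square algebra_simps)
    ultimately have "a * (4 + real (Suc n) * s) \<le> 4 + real n * (1 - a\<^sup>2)"
      by (simp add: s(3) add.commute)
    then show ?thesis using pos by (simp add: s_def[symmetric] field_simps)
  qed
  finally show ?case by (simp add: G_def)
qed

lemma transfer_iter_measurable [measurable]:
  "g \<in> borel_measurable borel \<Longrightarrow> (transfer ^^ n) g \<in> borel_measurable borel"
  by (induction n) auto

lemma invariant_integral_transfer_iter:
  assumes g: "mono_on {-1..1} g" "\<And>x. x \<in> {-1..1} \<Longrightarrow> g x \<in> {0..1}"
    and [measurable]: "g \<in> borel_measurable borel" "Z \<in> sets borel"
    and inv: "\<And>x. x \<in> circ \<Longrightarrow> fcirc x \<in> Z \<longleftrightarrow> x \<in> Z"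
  shows "(\<integral>x. (transfer ^^ n) g x * indicator Z x \<partial>lborel_circ) = (\<integral>x. g x * indicator Z x \<partial>lborel_circ)"
proof (induction n)
  case (Suc n)
  have "(\<integral>x. (transfer ^^ Suc n) g x * indicator Z x \<partial>lborel_circ)
      = (\<integral>x. (transfer ^^ n) g x * indicator Z (fcirc x) \<partial>lborel_circ)"
    unfolding funpow.simps o_def using transfer_iter(2)[OF g]
    by (intro integral_transfer[where C=1 and D=1, symmetric]) (auto simp: indicator_def)
  also have "\<dots> = (\<integral>x. (transfer ^^ n) g x * indicator Z x \<partial>lborel_circ)"
    using inv by (intro Bochner_Integration.integral_cong) (auto simp: space_lborel_circ indicator_def)
  finally show ?case using Suc by simp
qed simp

text \<open>On an invariant set \<open>Z\<close>, a monotone \<open>g\<close> has the same mean as on the whole circle (of length 2).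
The iterates \<open>G n\<close> of \<open>g\<close> have the same integrals over \<open>Z\<close> and over the circle as \<open>g\<close>, and
they flatten out to the constants \<open>G n 0\<close>, because their oscillation on compact subsets of the open
interval tends to 0.\<close>

lemma invariant_integral_mono:
  assumes g: "mono_on {-1..1} g" "\<And>x. x \<in> {-1..1} \<Longrightarrow> g x \<in> {0..1}"
    and [measurable]: "g \<in> borel_measurable borel" "Z \<in> sets borel" and "Z \<subseteq> circ"
    and inv: "\<And>x. x \<in> circ \<Longrightarrow> fcirc x \<in> Z \<longleftrightarrow> x \<in> Z"
  shows "2 * (\<integral>x. g x * indicator Z x \<partial>lborel_circ) =
    measure lborel_circ Z * (\<integral>x. g x * indicator circ x \<partial>lborel_circ)"
proof -
  define G where "G = (\<lambda>n. (transfer ^^ n) g)"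
  have [measurable]: "G n \<in> borel_measurable borel" for n by (simp add: G_def)
  have G01: "x \<in> {-1..1} \<Longrightarrow> G n x \<in> {0..1}" for n x
    unfolding G_def using transfer_iter(2)[OF g] by blast
  have dev: "\<bar>G n x - G n 0\<bar> \<le> 4 / (4 + real n * (1 - \<bar>x\<bar>))" if "x \<in> circ" for n x
  proof -
    have x: "\<bar>x\<bar> \<in> {0..1}" using that by (auto simp: circ_def)
    have "G n (- \<bar>x\<bar>) \<le> G n x" "G n x \<le> G n \<bar>x\<bar>" "G n (- \<bar>x\<bar>) \<le> G n 0" "G n 0 \<le> G n \<bar>x\<bar>"
      unfolding G_def using x by (intro mono_onD[OF transfer_iter(1)[OF g]]; auto)+
    then show ?thesis using transfer_oscillation[OF g x, of n] by (simp add: G_def)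
  qed
  have lim: "(\<lambda>n. (\<integral>x. g x * indicator A x \<partial>lborel_circ) - G n 0 * measure lborel_circ A) \<longlonglongrightarrow> 0"
    if A [measurable]: "A \<in> sets borel" and Ac: "A \<subseteq> circ"
      and Ainv: "\<And>x. x \<in> circ \<Longrightarrow> fcirc x \<in> A \<longleftrightarrow> x \<in> A" for A
  proof -
    have Am: "A \<in> sets lborel_circ" using A Ac by (auto simp: sets_restrict_space_iff)
    have int: "integrable lborel_circ (\<lambda>x. h x * indicator A x)"
      if [measurable]: "h \<in> borel_measurable borel" and "\<And>x. x \<in> {-1..1} \<Longrightarrow> h x \<in> {0..1}"
      for h :: "real \<Rightarrow> real"
    proof (rule lborel_circ.integrable_const_bound[where B=1])
      show "(\<lambda>x. h x * indicator A x) \<in> borel_measurable lborel_circ"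
        by (intro borel_imp_lborel_circ) measurable
    qed (use that(2) in \<open>auto simp: indicator_def space_lborel_circ circ_def\<close>)
    have "(\<lambda>n. \<integral>x. (G n x - G n 0) * indicator A x \<partial>lborel_circ) \<longlonglongrightarrow> (\<integral>x. 0 \<partial>lborel_circ)"
    proof (rule integral_dominated_convergence[where w="\<lambda>_. 1"])
      show "AE x in lborel_circ. norm ((G n x - G n 0) * indicator A x) \<le> 1" for n
      proof (rule AE_I2)
        fix x assume "x \<in> space lborel_circ"
        then have "x \<in> {-1..1}" by (auto simp: space_lborel_circ circ_def)
        with G01[of x n] G01[of 0 n] have "G n x \<in> {0..1}" "G n 0 \<in> {0..1}" by simp_all
        then show "norm ((G n x - G n 0) * indicator A x) \<le> 1"
          by (auto simp: indicator_def)
      qed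
      have "AE x in lborel_circ. x \<noteq> -1"
        using AE_lborel_singleton[of "-1::real"] by (auto simp: AE_restrict_space_iff)
      then show "AE x in lborel_circ. (\<lambda>n. (G n x - G n 0) * indicator A x) \<longlonglongrightarrow> 0"
      proof (rule AE_mp, intro AE_I2 impI)
        fix x assume x: "x \<in> space lborel_circ" "x \<noteq> -1"
        then have xc: "x \<in> circ" and p: "1 - \<bar>x\<bar> > 0" by (auto simp: space_lborel_circ circ_def)
        have "(\<lambda>n. 4 / (4 + real n * (1 - \<bar>x\<bar>))) \<longlonglongrightarrow> 0"
          using p by real_asymp
        then have "(\<lambda>n. G n x - G n 0) \<longlonglongrightarrow> 0"
          by (rule Lim_null_comparison[rotated]) (use dev[OF xc] in auto)
        then show "(\<lambda>n. (G n x - G n 0) * indicator A x) \<longlonglongrightarrow> 0"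
          by (rule tendsto_mult_left_zero)
      qed
    qed (auto intro!: borel_imp_lborel_circ)
    moreover have "(\<integral>x. (G n x - G n 0) * indicator A x \<partial>lborel_circ)
        = (\<integral>x. g x * indicator A x \<partial>lborel_circ) - G n 0 * measure lborel_circ A" for n
    proof -
      have "(\<integral>x. (G n x - G n 0) * indicator A x \<partial>lborel_circ)
         = (\<integral>x. G n x * indicator A x \<partial>lborel_circ) - (\<integral>x. G n 0 * indicator A x \<partial>lborel_circ)"
        unfolding left_diff_distrib using G01
        by (intro Bochner_Integration.integral_diff int) auto
      also have "(\<integral>x. G n x * indicator A x \<partial>lborel_circ) = (\<integral>x. g x * indicator A x \<partial>lborel_circ)"
        unfolding G_def using g Ainv by (intro invariant_integral_transfer_iter) auto
      finally show ?thesis using Am Ac by (simp add: space_lborel_circ Int_absorb2)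
    qed
    ultimately show ?thesis by simp
  qed
  define I where "I = (\<integral>x. g x * indicator circ x \<partial>lborel_circ)"
  have "measure lborel_circ circ = 2"
    by (simp add: measure_restrict_space circ_def)
  then have "(\<lambda>n. I - G n 0 * 2) \<longlonglongrightarrow> 0"
    using lim[of circ] fcirc_in_circ by (simp add: I_def)
  then have "(\<lambda>n. (I - (I - G n 0 * 2)) / 2) \<longlonglongrightarrow> (I - 0) / 2"
    by (intro tendsto_intros) auto
  then have "(\<lambda>n. (\<integral>x. g x * indicator Z x \<partial>lborel_circ) - G n 0 * measure lborel_circ Z)
     \<longlonglongrightarrow> (\<integral>x. g x * indicator Z x \<partial>lborel_circ) - I / 2 * measure lborel_circ Z"
    by (intro tendsto_intros) simp
  moreover have "(\<lambda>n. (\<integral>x. g x * indicator Z x \<partial>lborel_circ) - G n 0 * measure lborel_circ Z) \<longlonglongrightarrow> 0"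
    using \<open>Z \<subseteq> circ\<close> inv by (intro lim) auto
  ultimately have "(\<integral>x. g x * indicator Z x \<partial>lborel_circ) - I / 2 * measure lborel_circ Z = 0"
    by (rule LIMSEQ_unique)
  then show ?thesis by (simp add: I_def field_simps)
qed

section \<open>Frequency of visits to an expanding window\<close>

text \<open>The interval \<open>[1/16, 1/4)\<close> is an arbitrary window away from the exceptional set on which
\<open>\<bar>f'\<bar> \<ge> 2\<close>.\<close>

definition visits :: "nat \<Rightarrow> real \<Rightarrow> real" where
  "visits n x = (\<Sum>i<n. indicator {1/16..<1/4} ((fcirc ^^ i) x))"

lemma visits_Suc_fcirc: "visits (Suc n) x = indicator {1/16..<1/4} x + visits n (fcirc x)"
  unfolding visits_def sum.lessThan_Suc_shift by (simp add: funpow_swap1)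

lemma funpow_fcirc_borel [measurable]: "fcirc ^^ n \<in> borel_measurable borel"
  by (induction n) (simp_all add: id_def comp_def)

lemma visits_borel [measurable]: "visits n \<in> borel_measurable borel"
  unfolding visits_def[abs_def] by measurable

text \<open>The indicator of the window is a difference of two monotone functions; \<open>3/32\<close> is half its length
\<open>3/16\<close>.\<close>

lemma invariant_integral_window:
  assumes [measurable]: "Z \<in> sets borel" and "Z \<subseteq> circ"
    and inv: "\<And>x. x \<in> circ \<Longrightarrow> fcirc x \<in> Z \<longleftrightarrow> x \<in> Z"
  shows "(\<integral>x. indicator {1/16..<1/4} x * indicator Z x \<partial>lborel_circ) = 3/32 * measure lborel_circ Z"
proof -
  have half: "2 * (\<integral>x. indicator {t..} x * indicator Z x \<partial>lborel_circ) = measure lborel_circ Z * (1 - t)"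
    if t: "t \<in> {0..1}" for t :: real
  proof -
    have "2 * (\<integral>x. indicator {t..} x * indicator Z x \<partial>lborel_circ) =
        measure lborel_circ Z * (\<integral>x. indicator {t..} x * indicator circ x \<partial>lborel_circ)"
      by (intro invariant_integral_mono mono_onI assms(2) inv) (auto simp: indicator_def)
    also have "(\<integral>x. indicator {t..} x * indicator circ x \<partial>lborel_circ) = (LBINT x. indicator {t..<1} x :: real)"
      unfolding integral_lborel_circ using t
      by (intro Bochner_Integration.integral_cong) (auto simp: indicator_def circ_def)
    also have "\<dots> = 1 - t" using t by simp
    finally show ?thesis .
  qed
  have int: "integrable lborel_circ (\<lambda>x. indicator {t..} x * indicator Z x :: real)" for t :: real
    by (intro lborel_circ.integrable_const_bound[where B=1] borel_imp_lborel_circ) (auto simp: indicator_def)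
  have "(\<integral>x. indicator {1/16..<1/4} x * (indicator Z x :: real) \<partial>lborel_circ)
      = (\<integral>x. indicator {1/16..} x * indicator Z x - indicator {1/4..} x * indicator Z x \<partial>lborel_circ)"
    by (intro Bochner_Integration.integral_cong) (auto simp: indicator_def)
  also have "\<dots> = (\<integral>x. indicator {1/16..} x * indicator Z x \<partial>lborel_circ) - (\<integral>x. indicator {1/4..} x * indicator Z x \<partial>lborel_circ)"
    by (intro Bochner_Integration.integral_diff int)
  finally show ?thesis using half[of "1/16"] half[of "1/4"] by (simp add: field_simps)
qed

text \<open>Let \<open>Z\<close> be the set where \<open>visits n x - n / 16\<close> is unbounded below; as the terms are bounded, \<open>Z\<close> is
exactly invariant. On \<open>Z\<close> some Birkhoff sum of \<open>1/16 - indicator\<close> is positive, so its integral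
over \<open>Z\<close> is nonnegative by the maximal ergodic theorem. That integral is \<open>(1/16 - 3/32)\<close> times the
measure of \<open>Z\<close>, so \<open>Z\<close> is null. The rate \<open>1/16\<close> could be any positive number below \<open>3/32\<close>.\<close>

lemma AE_visits_linear: "AE x in lborel_circ. \<exists>K. \<forall>n. real n / 16 - real K \<le> visits n x"
proof -
  define Z where "Z = {x. x \<in> circ \<and> (\<forall>K::nat. \<exists>n. visits n x < real n / 16 - real K)}"
  have Zb [measurable]: "Z \<in> sets borel" unfolding Z_def by measurable
  have Zc: "Z \<subseteq> circ" by (auto simp: Z_def)
  then have Zm: "Z \<in> sets lborel_circ" using Zb by (auto simp: sets_restrict_space_iff)
  have inv: "fcirc x \<in> Z \<longleftrightarrow> x \<in> Z" if x: "x \<in> circ" for x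
  proof
    assume "fcirc x \<in> Z"
    then have *: "\<exists>n. visits n (fcirc x) < real n / 16 - real K" for K by (auto simp: Z_def)
    have "\<exists>n. visits n x < real n / 16 - real K" for K
    proof -
      obtain n where "visits n (fcirc x) < real n / 16 - real (K + 1)" using * by blast
      then have "visits (Suc n) x < real (Suc n) / 16 - real K"
        unfolding visits_Suc_fcirc by (auto simp: indicator_def add_divide_distrib)
      then show ?thesis by blast
    qed
    with x show "x \<in> Z" by (simp add: Z_def)
  next
    assume "x \<in> Z"
    then have *: "\<exists>n. visits n x < real n / 16 - real K" for K by (auto simp: Z_def)
    have "\<exists>n. visits n (fcirc x) < real n / 16 - real K" for K
    proof -
      obtain n where n: "visits n x < real n / 16 - real (K + 1)" using * by blast
      then obtain m where m: "n = Suc m" by (cases n) (auto simp: visits_def)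
      have "(0::real) \<le> indicator {1/16..<1/4} x" by simp
      with n have "visits m (fcirc x) < real m / 16 - real K"
        unfolding m visits_Suc_fcirc of_nat_Suc of_nat_add add_divide_distrib by linarith
      then show ?thesis by blast
    qed
    with fcirc_in_circ[OF x] show "fcirc x \<in> Z" by (simp add: Z_def)
  qed
  have "0 \<le> (\<integral>x. indicator Z x * (1/16 - indicator {1/16..<1/4} x :: real) \<partial>lborel_circ)"
  proof (rule lborel_circ.maximal_ergodic[OF fcirc_measurable_circ distr_fcirc])
    show "\<bar>1/16 - indicator {1/16..<1/4} x\<bar> \<le> (1::real)" for x :: real by (auto simp: indicator_def)
    show "\<exists>n. 0 < (\<Sum>i<n. 1/16 - indicator {1/16..<1/4} ((fcirc ^^ i) x) :: real)" if "x \<in> Z" for x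
    proof -
      have "\<exists>n. visits n x < real n / 16 - real 0" using that unfolding Z_def by blast
      then obtain n where "visits n x < real n / 16" by auto
      then show ?thesis by (intro exI[of _ n]) (simp add: sum_subtractf visits_def)
    qed
  qed (use inv Zm in \<open>auto simp: space_lborel_circ intro!: borel_imp_lborel_circ\<close>)
  also have "\<dots> = (\<integral>x. 1/16 * indicator Z x - indicator {1/16..<1/4} x * indicator Z x \<partial>lborel_circ)"
    by (simp add: algebra_simps)
  also have "\<dots> = (\<integral>x. 1/16 * indicator Z x \<partial>lborel_circ) - (\<integral>x. indicator {1/16..<1/4} x * indicator Z x \<partial>lborel_circ)"
    by (intro Bochner_Integration.integral_diff lborel_circ.integrable_const_bound[where B=1] borel_imp_lborel_circ)
       (auto simp: indicator_def)
  also have "\<dots> = 1/16 * measure lborel_circ Z - 3/32 * measure lborel_circ Z"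
    using invariant_integral_window[OF Zb Zc inv] Zc by (simp add: space_lborel_circ Int_absorb2)
  finally have "measure lborel_circ Z = 0"
    using measure_nonneg[of lborel_circ Z] by linarith
  then have "Z \<in> null_sets lborel_circ"
    using Zm by (auto simp: lborel_circ.emeasure_eq_measure)
  then have "AE x in lborel_circ. x \<notin> Z" by (rule AE_not_in)
  then show ?thesis
    by (rule AE_mp, intro AE_I2 impI) (auto simp: Z_def space_lborel_circ not_less)
qed

section \<open>Hyperbolic times from visits\<close>

text \<open>Pliss' lemma for increments at most 1. The set \<open>R\<close> consists of the times at which \<open>S n - c n\<close>
is at least all its previous values. The running maximum of this sequence rises only at such times,
and each time by at most 1, so there are at least as many of them as its current height.\<close>

lemma pliss_record_times:
  fixes S :: "nat \<Rightarrow> real"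
  assumes "\<And>n. S (Suc n) \<le> S n + 1" "S 0 = 0" "0 \<le> c"
  defines "R \<equiv> {n. 1 \<le> n \<and> (\<forall>k\<in>{1..n}. c * real k \<le> S n - S (n - k))}"
  shows "S n - c * real n \<le> real (card (R \<inter> {..n}))"
proof -
  have "\<forall>j\<le>n. S j - c * real j \<le> real (card (R \<inter> {..n}))"
  proof (induction n)
    case (Suc n)
    have le: "S j - c * real j \<le> real (card (R \<inter> {..Suc n}))" if "j \<le> n" for j
    proof -
      have "card (R \<inter> {..n}) \<le> card (R \<inter> {..Suc n})" by (intro card_mono) auto
      with Suc that show ?thesis by fastforce
    qed
    have "S (Suc n) - c * real (Suc n) \<le> real (card (R \<inter> {..Suc n}))"
    proof (cases "Suc n \<in> R")
      case True
      then have "R \<inter> {..Suc n} = insert (Suc n) (R \<inter> {..n})" by (auto simp: atMost_Suc)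
      then have "card (R \<inter> {..Suc n}) = Suc (card (R \<inter> {..n}))" by simp
      moreover have "S n - c * n \<le> card (R \<inter> {..n})" using Suc by simp
      ultimately show ?thesis using assms(1)[of n] \<open>0 \<le> c\<close> by (simp add: algebra_simps)
    next
      case False
      then obtain k where k: "k \<in> {1..Suc n}" "S (Suc n) - S (Suc n - k) < c * k"
        by (auto simp: R_def not_le)
      then have "real (Suc n) = real (Suc n - k) + real k" by auto
      then have "c * real (Suc n) = c * real (Suc n - k) + c * real k"
        by (simp only: distrib_left)
      with k le[of "Suc n - k"] show ?thesis by fastforce
    qed
    with le show ?case by (metis le_SucE)
  qed (simp add: assms)
  then show ?thesis by simp
qed

text \<open>A point at small distance \<open>d\<close> from the exceptional set needs at least about \<open>1 / (2 \<surd>d)\<close> steps to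
reach the window: near \<open>\<plusminus>1\<close> the escape takes about \<open>1 / d\<close> steps, and a point at distance
\<open>d\<close> from 0 is first mapped to distance at most \<open>2 \<surd>d\<close> from \<open>\<plusminus>1\<close>. For \<open>d = 0\<close> the number
\<open>N\<close> is arbitrary and the window is never reached.\<close>

lemma return_time_bound:
  assumes x: "x \<in> circ" and d: "circ_setdist x exceptional_set \<le> 1/32"
    and visit: "(fcirc ^^ j) x \<in> {1/16..<1/4}"
    and N: "0 \<le> N" "2 * sqrt (circ_setdist x exceptional_set) * N \<le> 1"
  shows "N \<le> real j + 2"
proof (rule ccontr)
  assume neg: "\<not> N \<le> real j + 2"
  define d where "d = circ_setdist x exceptional_set"
  have d_eq: "d = min \<bar>x\<bar> (1 - \<bar>x\<bar>)" using x by (simp add: d_def circ_setdist_exceptional_set)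
  have d01: "0 \<le> d" "d \<le> 1/32" using x d by (auto simp: d_eq circ_def d_def[symmetric])
  have contra: False
    if y: "y \<in> circ" and e: "1 - \<bar>y\<bar> \<le> 2 * sqrt d" and i: "(fcirc ^^ i) y \<in> {1/16..<1/4}" "i \<le> j" for y i
  proof -
    have "(1 - \<bar>y\<bar>) * N \<le> 2 * sqrt d * N" using e N by (intro mult_right_mono) auto
    also have "\<dots> \<le> 1" using N by (simp add: d_def)
    finally have "(1 - \<bar>(fcirc ^^ i) y\<bar>) * (N - real i) \<le> 1"
      using neg i by (intro escape_bound y) auto
    moreover have "3/4 * 2 \<le> (1 - \<bar>(fcirc ^^ i) y\<bar>) * (N - real i)"
      using neg i by (intro mult_mono) auto
    ultimately show False by simp
  qed
  show False
  proof (cases "d = \<bar>x\<bar>")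
    case True
    have "j \<noteq> 0"
    proof
      assume "j = 0"
      with visit True d01 show False by simp
    qed
    then obtain i where i: "j = Suc i" by (cases j) auto
    have "1 - \<bar>fcirc x\<bar> \<le> 2 * sqrt d"
      unfolding abs_fcirc True by linarith
    then show False
      using contra[OF fcirc_in_circ[OF x], of i] visit i by (simp add: funpow_swap1)
  next
    case False
    then have "1 - \<bar>x\<bar> = d" by (auto simp: d_eq min_def split: if_splits)
    moreover have "d \<le> sqrt d"
      using d01 by (intro real_le_rsqrt) (simp add: power2_eq_square mult_left_le)
    ultimately have "1 - \<bar>x\<bar> \<le> 2 * sqrt d" using d01 by simp
    then show False using contra[OF x] visit by blast
  qed
qed

text \<open>As \<open>d\<close> tends to 0, \<open>1 / \<surd>d\<close> grows faster than \<open>ln (1 / d)\<close>.\<close>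

lemma small_distance_scale:
  fixes \<sigma> b :: real
  assumes "0 < \<sigma>" "\<sigma> < 1" "0 < b"
  obtains \<delta> where "0 < \<delta>" "\<delta> \<le> 1/32"
    "\<And>d. 0 < d \<Longrightarrow> d \<le> \<delta> \<Longrightarrow> \<sigma> powr (b * (1 / (2 * sqrt d) - 1)) \<le> d"
proof -
  define l where "l = - ln \<sigma> * b"
  have l: "l > 0" using assms by (simp add: l_def mult_neg_pos)
  have "filterlim (\<lambda>d::real. l * (1 / (2 * sqrt d) - 1) + ln d) at_top (at_right 0)"
    using l by real_asymp
  then have "\<forall>\<^sub>F d in at_right 0. 0 < l * (1 / (2 * sqrt d) - 1) + ln d"
    by (simp add: filterlim_at_top_dense)
  then obtain \<delta> where \<delta>: "\<delta> > 0" "\<And>d. 0 < d \<Longrightarrow> d < \<delta> \<Longrightarrow> 0 < l * (1 / (2 * sqrt d) - 1) + ln d"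
    by (auto simp: eventually_at_right_field)
  show thesis
  proof (rule that[of "min (\<delta> / 2) (1/32)"])
    fix d :: real assume d: "0 < d" "d \<le> min (\<delta> / 2) (1/32)"
    have "\<sigma> powr (b * (1 / (2 * sqrt d) - 1)) = exp (- (l * (1 / (2 * sqrt d) - 1)))"
      using assms by (simp add: powr_def l_def)
    also have "\<dots> \<le> exp (ln d)"
      unfolding exp_le_cancel_iff using \<delta>(2)[of d] d \<delta>(1) by linarith
    finally show "\<sigma> powr (b * (1 / (2 * sqrt d) - 1)) \<le> d" using d by simp
  qed (use \<delta> in auto)
qed

text \<open>Since \<open>\<bar>f'\<bar> \<ge> 1\<close> everywhere and \<open>\<bar>f'\<bar> \<ge> 2\<close> on the window, the hypothesis \<open>rec\<close> yields
the expansion condition for this \<open>\<sigma>\<close>. It also yields the distance condition: \<open>rec\<close> forces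
the orbit of \<open>(f ^^ (n - k)) x\<close> to visit the window within fewer than \<open>k\<close> steps, so by the return time bound
\<open>k\<close> is at least about \<open>1 / (2 \<surd>d)\<close>, and \<open>\<delta>\<close> was chosen so small that then \<open>\<sigma> powr (b k) \<le> d\<close>.\<close>

lemma record_imp_hyperbolic_time:
  assumes x: "x \<in> circ" and b: "0 < b" and n: "1 \<le> n"
    and rec: "\<And>k. k \<in> {1..n} \<Longrightarrow> real k / 32 \<le> visits n x - visits (n - k) x"
    and \<sigma>: "\<sigma> = (1/2) powr (1/32)" and \<delta>: "\<delta> \<le> 1/32"
      "\<And>d. 0 < d \<Longrightarrow> d \<le> \<delta> \<Longrightarrow> \<sigma> powr (b * (1 / (2 * sqrt d) - 1)) \<le> d"
  shows "hyperbolic_time fcirc exceptional_set b \<sigma> \<delta> x n"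
  unfolding hyperbolic_time_def
proof (intro conjI ballI n)
  fix k assume k: "k \<in> {1..n}"
  have \<sigma>01: "0 < \<sigma>" "\<sigma> < 1" by (simp_all add: \<sigma> powr_def)
  let ?E = "{1/16..<1/4::real}"
  let ?x = "\<lambda>j. (fcirc ^^ j) x"
  have xc: "?x j \<in> circ" for j using x by (rule funpow_fcirc_in_circ)
  have far: "0 < circ_setdist (?x (n - i)) exceptional_set \<and>
      (circ_setdist (?x (n - i)) exceptional_set \<le> \<delta> \<longrightarrow>
       \<sigma> powr (b * real i) \<le> circ_setdist (?x (n - i)) exceptional_set)" if i: "i \<in> {1..n}" for i
  proof -
    define y where "y = ?x (n - i)"
    define d where "d = circ_setdist y exceptional_set"
    have yc: "y \<in> circ" using xc by (simp add: y_def)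
    have d0: "0 \<le> d" using yc by (auto simp: d_def circ_setdist_exceptional_set circ_def)
    have "visits n x - visits (n - i) x = (\<Sum>j=n-i..<n. indicator ?E (?x j))"
      using i unfolding visits_def lessThan_atLeast0 by (subst sum_diff_nat_ivl) auto
    moreover have "0 < visits n x - visits (n - i) x" using rec[OF i] i by simp
    ultimately have "\<exists>j\<in>{n - i..<n}. ?x j \<in> ?E"
      by (metis (no_types, lifting) indicator_simps(2) less_irrefl sum.neutral)
    then obtain j where j: "j \<in> {n - i..<n}" "?x j \<in> ?E" by blast
    have "?x j = (fcirc ^^ (j - (n - i))) y"
      using j unfolding y_def by (metis add_diff_cancel_left' atLeastLessThan_iff comp_apply funpow_add le_add_diff_inverse2)
    with j have vis: "(fcirc ^^ (j - (n - i))) y \<in> ?E" by simp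
    have ret: "N \<le> real i + 1" if "d \<le> 1/32" "0 \<le> N" "2 * sqrt d * N \<le> 1" for N
    proof -
      have "N \<le> real (j - (n - i)) + 2"
        using that vis yc by (intro return_time_bound[of y]) (auto simp: d_def)
      moreover have "real (j - (n - i)) + 1 \<le> real i" using i j by auto
      ultimately show ?thesis by linarith
    qed
    have dpos: "0 < d"
    proof (rule ccontr)
      assume "\<not> 0 < d"
      then have "d = 0" using d0 by simp
      then show False using ret[of "real i + 2"] by simp
    qed
    moreover have "\<sigma> powr (b * real i) \<le> d" if "d \<le> \<delta>"
    proof -
      have "1 / (2 * sqrt d) \<le> real i + 1" using that \<delta>(1) dpos by (intro ret) auto
      then have "\<sigma> powr (b * real i) \<le> \<sigma> powr (b * (1 / (2 * sqrt d) - 1))"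
        using b \<sigma>01 by (intro powr_mono') (auto intro!: mult_left_mono)
      also have "\<dots> \<le> d" using dpos that by (rule \<delta>(2))
      finally show ?thesis .
    qed
    ultimately show ?thesis by (simp add: d_def y_def)
  qed
  have "\<sigma> powr (b * real k) \<le> 1"
    using b \<sigma>01 by (simp add: powr_le_one_le powr_le1)
  then show "\<sigma> powr (b * real k) \<le> trunc_setdist \<delta> (?x (n - k)) exceptional_set"
    using far[OF k] by (simp add: trunc_setdist_def)
  have "(\<Prod>j = n - k..<n. inverse \<bar>deriv fcirc (?x j)\<bar>) \<le> (\<Prod>j = n - k..<n. (1/2) powr indicator ?E (?x j))"
  proof (rule prod_mono)
    fix j assume j: "j \<in> {n - k..<n}"
    have "0 < circ_setdist (?x j) exceptional_set" using far[of "n - j"] j by auto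
    then have nz: "?x j \<noteq> 0" using xc by (auto simp: circ_setdist_exceptional_set)
    have eq: "inverse \<bar>deriv fcirc (?x j)\<bar> = sqrt \<bar>?x j\<bar>"
      using deriv_fcirc[OF xc nz] by simp
    have "sqrt \<bar>?x j\<bar> \<le> (1/2) powr indicator ?E (?x j)"
    proof (cases "?x j \<in> ?E")
      case True
      then have "sqrt \<bar>?x j\<bar> \<le> 1/2" by (intro real_le_lsqrt) (auto simp: power2_eq_square)
      with True show ?thesis by simp
    next
      case False
      have "\<bar>?x j\<bar> \<le> 1" using xc[of j] by (auto simp: circ_def)
      with False show ?thesis by simp
    qed
    with eq show "0 \<le> inverse \<bar>deriv fcirc (?x j)\<bar> \<and> inverse \<bar>deriv fcirc (?x j)\<bar> \<le> (1/2) powr indicator ?E (?x j)"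
      by simp
  qed
  also have "\<dots> = (1/2) powr (\<Sum>j = n - k..<n. indicator ?E (?x j))"
    by (simp add: powr_sum)
  also have "(\<Sum>j = n - k..<n. indicator ?E (?x j)) = visits n x - visits (n - k) x"
    using k unfolding visits_def lessThan_atLeast0 by (subst sum_diff_nat_ivl) auto
  also have "(1/2) powr (visits n x - visits (n - k) x) \<le> (1/2) powr (1/32 * real k)"
    using rec[OF k] by (intro powr_mono') auto
  also have "\<dots> = \<sigma> ^ k"
    by (simp add: \<sigma> powr_powr flip: powr_realpow)
  finally show "(\<Prod>j = n - k..<n. inverse \<bar>deriv fcirc (?x j)\<bar>) \<le> \<sigma> ^ k" .
qed

text \<open>Applying Pliss' lemma with half the rate \<open>1/16\<close> leaves \<open>n / 32 - K\<close> record times up to \<open>n\<close>,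
which is at least \<open>n / 64\<close> once \<open>n \<ge> 64 K\<close>.\<close>

lemma linear_visits_imp_frequency:
  assumes x: "x \<in> circ" and b: "0 < b"
    and K: "\<And>n. real n / 16 - real K \<le> visits n x"
    and \<sigma>: "\<sigma> = (1/2) powr (1/32)" and \<delta>: "\<delta> \<le> 1/32"
      "\<And>d. 0 < d \<Longrightarrow> d \<le> \<delta> \<Longrightarrow> \<sigma> powr (b * (1 / (2 * sqrt d) - 1)) \<le> d"
  shows "hyperbolic_frequency_bigger fcirc exceptional_set b \<sigma> \<delta> (1/64) x"
  unfolding hyperbolic_frequency_bigger_def
proof (rule eventually_sequentiallyI[of "64 * K"])
  fix n assume n: "64 * K \<le> n"
  define R where "R = {n. 1 \<le> n \<and> (\<forall>k\<in>{1..n}. 1/32 * real k \<le> visits n x - visits (n - k) x)}"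
  have "visits n x - 1/32 * real n \<le> real (card (R \<inter> {..n}))"
    unfolding R_def
    by (rule pliss_record_times) (auto simp: visits_def indicator_def)
  moreover have "64 * real K \<le> real n" using n by (simp flip: of_nat_mult of_nat_le_iff)
  ultimately have "1/64 * real n \<le> real (card (R \<inter> {..n}))" using K[of n] by linarith
  moreover have "hyperbolic_time fcirc exceptional_set b \<sigma> \<delta> x t" if "t \<in> R" for t
    using that by (intro record_imp_hyperbolic_time[OF x b _ _ \<sigma> \<delta>]) (auto simp: R_def)
  ultimately show "\<exists>T\<subseteq>{..n}. (\<forall>t\<in>T. hyperbolic_time fcirc exceptional_set b \<sigma> \<delta> x t) \<and> 1/64 * real n \<le> real (card T)"
    by (intro exI[of _ "R \<inter> {..n}"]) auto
qed

section \<open>Conclusion\<close>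

lemma AE_circ_measureI:
  assumes "AE x in lborel_circ. P x"
  shows "AE x in circ_measure. P x"
proof -
  have "AE x in lborel. x \<in> circ \<longrightarrow> P x"
    using assms by (subst (asm) AE_restrict_space_iff) auto
  then have "AE x in lebesgue. x \<in> circ \<longrightarrow> P x" by (rule AE_completion)
  then have "AE x in restrict_space lebesgue circ. P x"
    by (subst AE_restrict_space_iff) auto
  then obtain N where N: "{x \<in> space (restrict_space lebesgue circ). \<not> P x} \<subseteq> N"
      "emeasure (restrict_space lebesgue circ) N = 0" "N \<in> sets (restrict_space lebesgue circ)"
    by (rule AE_E)
  then show ?thesis
    unfolding circ_measure_def by (intro AE_I[of _ _ N]) (auto simp: space_scale_measure)
qed

theorem mainTheorem4:
  fixes B \<beta> b :: real
  assumes "B > 1" and "\<beta> > 0"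
    and "nondegenerate_exceptional fcirc exceptional_set B \<beta>"
    and "0 < b" and "b < min (1/2) (1 / (4 * \<beta>))"
  shows "(\<exists>\<sigma> \<delta> \<theta> :: real. 0 < \<sigma> \<and> \<sigma> < 1 \<and> \<delta> > 0 \<and> \<theta> > 0 \<and>
            (AE x in circ_measure.
               hyperbolic_frequency_bigger fcirc exceptional_set b \<sigma> \<delta> \<theta> x)) \<and>
         (\<forall>\<sigma> \<delta> :: real. 0 < \<sigma> \<and> \<sigma> < 1 \<and> \<delta> > 0 \<longrightarrow>
            (\<integral>\<^sup>+ x. first_hyperbolic_time fcirc exceptional_set b \<sigma> \<delta> x \<partial>circ_measure) = \<infinity>)"
proof (intro conjI allI impI)
  define \<sigma> :: real where "\<sigma> = (1/2) powr (1/32)"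
  have \<sigma>: "0 < \<sigma>" "\<sigma> < 1" by (simp_all add: \<sigma>_def powr_def)
  obtain \<delta> where \<delta>: "0 < \<delta>" "\<delta> \<le> 1/32"
      "\<And>d. 0 < d \<Longrightarrow> d \<le> \<delta> \<Longrightarrow> \<sigma> powr (b * (1 / (2 * sqrt d) - 1)) \<le> d"
    using small_distance_scale[OF \<sigma> \<open>0 < b\<close>] by blast
  have "AE x in circ_measure. hyperbolic_frequency_bigger fcirc exceptional_set b \<sigma> \<delta> (1/64) x"
  proof (rule AE_circ_measureI, rule AE_mp[OF AE_visits_linear], intro AE_I2 impI)
    fix x assume "x \<in> space lborel_circ" "\<exists>K. \<forall>n. real n / 16 - real K \<le> visits n x"
    then show "hyperbolic_frequency_bigger fcirc exceptional_set b \<sigma> \<delta> (1/64) x"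
      using linear_visits_imp_frequency[OF _ \<open>0 < b\<close> _ \<sigma>_def \<delta>(2,3)]
      by (auto simp: space_lborel_circ)
  qed
  then show "\<exists>\<sigma> \<delta> \<theta> :: real. 0 < \<sigma> \<and> \<sigma> < 1 \<and> \<delta> > 0 \<and> \<theta> > 0 \<and>
            (AE x in circ_measure. hyperbolic_frequency_bigger fcirc exceptional_set b \<sigma> \<delta> \<theta> x)"
    using \<sigma> \<delta>(1) by (intro exI[of _ \<sigma>] exI[of _ \<delta>] exI[of _ "1/64"]) auto
next
  fix \<sigma> \<delta> :: real assume "0 < \<sigma> \<and> \<sigma> < 1 \<and> \<delta> > 0"
  then show "(\<integral>\<^sup>+ x. first_hyperbolic_time fcirc exceptional_set b \<sigma> \<delta> x \<partial>circ_measure) = \<infinity>"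
    by (intro first_hyperbolic_time_not_integrable) auto
qed

end
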